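(* Let $X$ be a lush Banach space over $\mathbb{K}$, where $\mathbb{K}=\mathbb{R}$ or $\mathbb{K}=\mathbb{C}$ (in particular, $X$ may be complex). Then $n_L(X)=1$.
   Context: $X$ is a Banach space over $\mathbb{K}$ ($\mathbb{K}=\mathbb{R}$ or $\mathbb{K}=\mathbb{C}$) with unit sphere $S_X$ and dual $X^*$; $\mathbb{T}=\{\theta\in\mathbb{K}:|\theta|=1\}$ is the set of scalars of modulus one, and $\operatorname{Re}$ denotes the real part (the identity when the scalars are real). For $y^*\in S_{X^*}$ and $\varepsilon>0$ put $S(S_X,\operatorname{Re}y^*,\varepsilon)=\{x\in S_X:\operatorname{Re}y^*(x)>1-\varepsilon\}$. $X$ is lush if for every $x,y\in S_X$ and every $\varepsilon>0$ there is $y^*\in S_{X^*}$ such that, with $S=S(S_X,\operatorname{Re}y^*,\varepsilon)$, one has $y\in S$ and $\operatorname{dist}(x,\operatorname{conv}(\mathbb{T}S))<\varepsilon$, where $\operatorname{conv}$ denotes the convex hull. $\operatorname{Lip}(X)$ is the space of Lipschitz maps $T:X\to X$ (not necessarily linear), with $\|T\|=\sup\left\{\frac{\|T(x_1)-T(x_2)\|}{\|x_1-x_2\|}:x_1\neq x_2\in X\right\}$ (formally modulo constants, or equivalently with $T(0)=0$). For $T\in\operatorname{Lip}(X)$, $$V(T):=\left\{\frac{f(Tx-Ty)}{\|x-y\|^2}: x,y\in X,\ x\neq y,\ f\in X^*,\ \operatorname{Re}f(x-y)=\|f\|\,\|x-y\|=\|x-y\|^2\right\},$$ $v(T)=\sup\{|\lambda|:\lambda\in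 V(T)\}$, and the Lipschitz numerical index of $X$ is $n_L(X)=\inf\{v(T):T\in\operatorname{Lip}(X),\ \|T\|=1\}$. *)

theory Defs
  imports "HOL-Analysis.Analysis"
begin

text \<open>
  Everything is parametrised by the scalar multiplication \<open>scl\<close> of \<open>X\<close> over a field type
  \<open>'k\<close> and, where needed, by the real-part map \<open>re\<close> of \<open>'k\<close>. The intended instances are
  \<open>'k = real\<close> with \<open>(*\<^sub>R)\<close> and the identity, and \<open>'k = complex\<close> with a complex structure as
  below and \<open>Re\<close>. The underlying real Banach space is the type \<open>'a\<close>.
\<close>

locale normed_space_over = vector_space scl
  for scl :: "'k::real_normed_field \<Rightarrow> 'a::real_normed_vector \<Rightarrow> 'a" +
  assumes norm_scale: "norm (scl c x) = norm c * norm x"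
    and scale_of_real: "scl (of_real r) x = r *\<^sub>R x"

definition dual ::
  "('k::real_normed_field \<Rightarrow> 'a::real_normed_vector \<Rightarrow> 'a) \<Rightarrow> ('a \<Rightarrow> 'k) set" where
  "dual scl = {f. bounded_linear f \<and> (\<forall>c x. f (scl c x) = c * f x)}"

definition slice ::
  "('k::real_normed_field \<Rightarrow> real) \<Rightarrow> ('a::real_normed_vector \<Rightarrow> 'k) \<Rightarrow> real \<Rightarrow> 'a set" where
  "slice re f \<epsilon> = {x \<in> sphere 0 1. re (f x) > 1 - \<epsilon>}"

text \<open>The distance is never the default value of \<^const>\<open>infdist\<close> for the empty set, since
  \<open>y\<close> belongs to the slice.\<close>

definition lush ::
  "('k::real_normed_field \<Rightarrow> real) \<Rightarrow> ('k \<Rightarrow> 'a::real_normed_vector \<Rightarrow> 'a) \<Rightarrow> bool" where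
  "lush re scl \<longleftrightarrow>
    (\<forall>x\<in>sphere 0 1. \<forall>y\<in>sphere 0 1. \<forall>\<epsilon>>0. \<exists>f\<in>dual scl. onorm f = 1 \<and>
       y \<in> slice re f \<epsilon> \<and>
       infdist x (convex hull {scl \<theta> s | \<theta> s. norm \<theta> = 1 \<and> s \<in> slice re f \<epsilon>}) < \<epsilon>)"

text \<open>Constants are not factored out of the space of Lipschitz maps: its norm and the numerical
  range only involve differences \<open>T x - T y\<close>.\<close>

definition Lip :: "('a::real_normed_vector \<Rightarrow> 'a) set" where
  "Lip = {T. \<exists>L. L-lipschitz_on UNIV T}"

definition lip_norm :: "('a::real_normed_vector \<Rightarrow> 'a) \<Rightarrow> real" where
  "lip_norm T = Sup {norm (T x1 - T x2) / norm (x1 - x2) | x1 x2. x1 \<noteq> x2}"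

definition num_range ::
  "('k::real_normed_field \<Rightarrow> real) \<Rightarrow> ('k \<Rightarrow> 'a::real_normed_vector \<Rightarrow> 'a) \<Rightarrow> ('a \<Rightarrow> 'a) \<Rightarrow> 'k set"
  where
  "num_range re scl T =
    {f (T x - T y) / of_real ((norm (x - y))\<^sup>2) | x y f. x \<noteq> y \<and> f \<in> dual scl \<and>
       re (f (x - y)) = onorm f * norm (x - y) \<and> onorm f * norm (x - y) = (norm (x - y))\<^sup>2}"

text \<open>For \<open>T\<close> in \<open>Lip\<close> and \<open>X \<noteq> {0}\<close> the suprema and the infimum below are over nonempty bounded
  sets of reals: the numerical range lies in the disc of radius \<open>lip_norm T\<close>, and the identity has
  norm one.\<close>

definition num_radius ::
  "('k::real_normed_field \<Rightarrow> real) \<Rightarrow> ('k \<Rightarrow> 'a::real_normed_vector \<Rightarrow> 'a) \<Rightarrow> ('a \<Rightarrow> 'a) \<Rightarrow> real"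
  where
  "num_radius re scl T = Sup {norm z | z. z \<in> num_range re scl T}"

definition lip_num_index ::
  "('k::real_normed_field \<Rightarrow> real) \<Rightarrow> ('k \<Rightarrow> 'a::real_normed_vector \<Rightarrow> 'a) \<Rightarrow> real" where
  "lip_num_index re scl = Inf {num_radius re scl T | T. T \<in> Lip \<and> lip_norm T = 1}"

end

theory Submission
  imports Defs
begin

text \<open>
  Suppose \<open>T\<close> has norm one and nearly attains it on the pair \<open>a, b\<close>. Lushness, applied to the
  directions of \<open>a - b\<close> and \<open>T a - T b\<close>, gives a functional \<open>f\<close> such that \<open>Re (f \<circ> T)\<close> grows at almost
  unit rate from \<open>b\<close> to \<open>a\<close>, while \<open>a - b\<close> is nearly proportional to a convex combination of
  vectors \<open>\<theta> s\<close> with \<open>f s\<close> close to \<open>1\<close>. Replacing the segment from \<open>b\<close> to \<open>a\<close> by a polygon whose edges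
  are parallel to these vectors, without increase of length, one finds a single edge along which
  \<open>Re (f \<circ> T)\<close> still grows at almost unit rate. A small perturbation of the end of that
  edge then yields a pair whose norming functionals give points of the numerical range of modulus
  close to \<open>1\<close>.
\<close>

section \<open>Norming functionals\<close>

definition sublinear :: "('a::real_vector \<Rightarrow> real) \<Rightarrow> bool" where
  "sublinear p \<longleftrightarrow> (\<forall>x y. p (x + y) \<le> p x + p y) \<and> (\<forall>t\<ge>0. \<forall>x. p (t *\<^sub>R x) \<le> t * p x)"

lemma sublinear_add: "sublinear p \<Longrightarrow> p (x + y) \<le> p x + p y"
  and sublinear_scale_le: "sublinear p \<Longrightarrow> 0 \<le> t \<Longrightarrow> p (t *\<^sub>R x) \<le> t * p x"
  by (auto simp: sublinear_def)

lemma sublinear_zero: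
  assumes "sublinear p"
  shows "p 0 = 0"
  using sublinear_add[OF assms, of 0 0] sublinear_scale_le[OF assms, of 0 0] by simp

lemma sublinear_scale:
  assumes "sublinear p" "0 \<le> t"
  shows "p (t *\<^sub>R x) = t * p x"
proof (cases "t = 0")
  case True
  then show ?thesis by (simp add: sublinear_zero[OF assms(1)])
next
  case False
  then have t: "t > 0" using assms by simp
  have "p ((1 / t) *\<^sub>R (t *\<^sub>R x)) \<le> (1 / t) * p (t *\<^sub>R x)"
    using t by (intro sublinear_scale_le assms) auto
  then have "t * p x \<le> p (t *\<^sub>R x)"
    using t by (simp add: field_simps)
  then show ?thesis
    using sublinear_scale_le[OF assms] by (simp add: order_antisym)
qed

lemma sublinear_minus_le:
  assumes "sublinear p"
  shows "- p (- x) \<le> p x"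
  using sublinear_add[OF assms, of x "- x"] sublinear_zero[OF assms] by simp

text \<open>The largest sublinear functional below \<open>p\<close> taking the value \<open>- p y\<close> at \<open>- y\<close>.\<close>

definition sublinear_at :: "('a::real_vector \<Rightarrow> real) \<Rightarrow> 'a \<Rightarrow> 'a \<Rightarrow> real" where
  "sublinear_at p y x = (INF t\<in>{0..}. p (x + t *\<^sub>R y) - t * p y)"

lemma sublinear_at_le:
  assumes "sublinear p" "0 \<le> t"
  shows "sublinear_at p y x \<le> p (x + t *\<^sub>R y) - t * p y"
  unfolding sublinear_at_def
proof (rule cINF_lower)
  show "bdd_below ((\<lambda>t. p (x + t *\<^sub>R y) - t * p y) ` {0..})"
  proof (rule bdd_belowI2)
    fix t :: real assume "t \<in> {0..}"
    then show "- p (- x) \<le> p (x + t *\<^sub>R y) - t * p y"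
      using sublinear_add[OF assms(1), of "- x" "x + t *\<^sub>R y"] sublinear_scale[OF assms(1), of t y]
      by simp
  qed
qed (use assms in auto)

lemma sublinear_at_greatest:
  assumes "\<And>t. 0 \<le> t \<Longrightarrow> m \<le> p (x + t *\<^sub>R y) - t * p y"
  shows "m \<le> sublinear_at p y x"
  unfolding sublinear_at_def using assms by (intro cINF_greatest) auto

lemma sublinear_at_le_self: "sublinear p \<Longrightarrow> sublinear_at p y x \<le> p x"
  using sublinear_at_le[of p 0 y x] by simp

text \<open>If t and t' serve for x and x', then t + t' is admissible for x + x'; under scaling by
  s, t becomes s * t.\<close>

lemma sublinear_sublinear_at:
  assumes p: "sublinear p"
  shows "sublinear (sublinear_at p y)"
  unfolding sublinear_def
proof (intro conjI allI impI)
  fix x x'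
  have "sublinear_at p y (x + x') - (p (x' + t' *\<^sub>R y) - t' * p y) \<le> sublinear_at p y x"
    if "0 \<le> t'" for t'
  proof (rule sublinear_at_greatest)
    fix t :: real assume "0 \<le> t"
    then show "sublinear_at p y (x + x') - (p (x' + t' *\<^sub>R y) - t' * p y) \<le> p (x + t *\<^sub>R y) - t * p y"
      using sublinear_at_le[OF p, of "t + t'" y "x + x'"] that
        sublinear_add[OF p, of "x + t *\<^sub>R y" "x' + t' *\<^sub>R y"]
      by (simp add: algebra_simps)
  qed
  then have "sublinear_at p y (x + x') - sublinear_at p y x \<le> sublinear_at p y x'"
    by (intro sublinear_at_greatest) (simp add: algebra_simps)
  then show "sublinear_at p y (x + x') \<le> sublinear_at p y x + sublinear_at p y x'"
    by simp
next
  fix s :: real and x assume "0 \<le> s"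
  show "sublinear_at p y (s *\<^sub>R x) \<le> s * sublinear_at p y x"
  proof (cases "s = 0")
    case True
    then show ?thesis
      using sublinear_at_le_self[OF p, of y 0] sublinear_zero[OF p] by simp
  next
    case False
    with \<open>0 \<le> s\<close> have s: "0 < s" by simp
    have "sublinear_at p y (s *\<^sub>R x) / s \<le> sublinear_at p y x"
    proof (rule sublinear_at_greatest)
      fix t :: real assume "0 \<le> t"
      then have "sublinear_at p y (s *\<^sub>R x) \<le> p (s *\<^sub>R (x + t *\<^sub>R y)) - (s * t) * p y"
        using sublinear_at_le[OF p, of "s * t" y "s *\<^sub>R x"] s by (simp add: algebra_simps)
      also have "\<dots> \<le> s * (p (x + t *\<^sub>R y) - t * p y)"
        using sublinear_scale_le[OF p, of s "x + t *\<^sub>R y"] s by (simp add: algebra_simps)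
      finally show "sublinear_at p y (s *\<^sub>R x) / s \<le> p (x + t *\<^sub>R y) - t * p y"
        using s by (simp add: field_simps)
    qed
    then show ?thesis using s by (simp add: field_simps)
  qed
qed

text \<open>Supplies the lower bounds for Zorn's lemma. Subadditivity of the infimum uses the chain:
  of two members one lies below the other, so both summands can be estimated by a single
  functional.\<close>

lemma sublinear_INF_chain:
  assumes C: "\<And>q. q \<in> C \<Longrightarrow> sublinear q \<and> q \<le> p"
    and chain: "\<And>q r. q \<in> C \<Longrightarrow> r \<in> C \<Longrightarrow> q \<le> r \<or> r \<le> q"
    and "C \<noteq> {}"
  defines "u \<equiv> \<lambda>x. INF q\<in>C. q x"
  shows "sublinear u" and "\<And>q. q \<in> C \<Longrightarrow> u \<le> q"
proof -
  have le: "u x \<le> q x" if "q \<in> C" for q x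
    unfolding u_def
  proof (rule cINF_lower)
    show "bdd_below ((\<lambda>q. q x) ` C)"
    proof (rule bdd_belowI2)
      fix q assume "q \<in> C"
      \<comment> \<open>By \<open>sublinear_minus_le\<close>, q x is at least - q (- x), which q
        \<le> p bounds below independently of q.\<close>
      then show "- p (- x) \<le> q x"
        using sublinear_minus_le[of q x] le_funD[of q p "- x"] C by force
    qed
  qed (use that in auto)
  have ge: "m \<le> u x" if "\<And>q. q \<in> C \<Longrightarrow> m \<le> q x" for m x
    unfolding u_def using that \<open>C \<noteq> {}\<close> by (intro cINF_greatest) auto
  show "u \<le> q" if "q \<in> C" for q
    using le that by (simp add: le_fun_def)
  show "sublinear u"
    unfolding sublinear_def
  proof (intro conjI allI impI)
    fix x y
    have "u (x + y) \<le> q x + r y" if qr: "q \<in> C" "r \<in> C" for q r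
    proof -
      obtain m where m: "m \<in> C" "m \<le> q" "m \<le> r"
        using chain[OF qr] qr by blast
      have "u (x + y) \<le> m x + m y"
        using le[OF m(1), of "x + y"] sublinear_add[of m x y] C m(1) by fastforce
      then show ?thesis
        using le_funD[OF m(2), of x] le_funD[OF m(3), of y] by simp
    qed
    then have "u (x + y) - r y \<le> u x" if "r \<in> C" for r
      using that by (intro ge) (simp add: algebra_simps)
    then have "u (x + y) - u x \<le> u y"
      by (intro ge) (simp add: algebra_simps)
    then show "u (x + y) \<le> u x + u y" by simp
  next
    fix t :: real and x assume "0 \<le> t"
    have *: "u (t *\<^sub>R x) \<le> t * q x" if "q \<in> C" for q
      using le[OF that, of "t *\<^sub>R x"] sublinear_scale_le[of q t x] C that \<open>0 \<le> t\<close> by fastforce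
    show "u (t *\<^sub>R x) \<le> t * u x"
    proof (cases "t = 0")
      case True
      then show ?thesis using * \<open>C \<noteq> {}\<close> by fastforce
    next
      case False
      with \<open>0 \<le> t\<close> have "0 < t" by simp
      then have "u (t *\<^sub>R x) / t \<le> u x"
        using * by (intro ge) (simp add: field_simps)
      then show ?thesis using \<open>0 < t\<close> by (simp add: field_simps)
    qed
  qed
qed

text \<open>A minimal sublinear functional \<open>m\<close> equals \<open>sublinear_at m y\<close> for every \<open>y\<close>, which forces
  additivity.\<close>

lemma sublinear_dominates_linear:
  assumes p: "sublinear p"
  obtains f where "linear f" "\<And>x. f x \<le> p x"
proof -
  let ?A = "{q. sublinear q \<and> q \<le> p}"
  have "\<exists>m\<in>?A. \<forall>q\<in>?A. q \<le> m \<longrightarrow> q = m"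
  proof (rule predicate_Zorn)
    \<comment> \<open>The order is reversed, so that maximal elements are minimal
      functionals.\<close>
    show "partial_order_on ?A (relation_of (\<lambda>q r. r \<le> q) ?A)"
      by (rule partial_order_on_relation_ofI) auto
  next
    fix C assume "C \<in> Chains (relation_of (\<lambda>q r. r \<le> q) ?A)"
    then have C: "\<And>q. q \<in> C \<Longrightarrow> sublinear q \<and> q \<le> p"
      and chain: "\<And>q r. q \<in> C \<Longrightarrow> r \<in> C \<Longrightarrow> q \<le> r \<or> r \<le> q"
      by (auto simp: Chains_def relation_of_def)
    show "\<exists>u\<in>?A. \<forall>q\<in>C. u \<le> q"
    proof (cases "C = {}")
      case True
      then show ?thesis using p by auto
    next
      case False
      then obtain r where "r \<in> C" by blast
      with sublinear_INF_chain[of C p, OF C chain False] C show ?thesis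
        by (intro bexI[of _ "\<lambda>x. INF q\<in>C. q x"]) (auto intro: order_trans[of _ r])
    qed
  qed
  then obtain m where m: "sublinear m" "m \<le> p"
    and minimal: "\<And>q. sublinear q \<Longrightarrow> q \<le> p \<Longrightarrow> q \<le> m \<Longrightarrow> q = m"
    by auto
  have at: "sublinear_at m y = m" for y
  proof (rule minimal)
    show "sublinear_at m y \<le> m"
      using sublinear_at_le_self[OF m(1)] by (simp add: le_fun_def)
    then show "sublinear_at m y \<le> p" using m(2) by (rule order_trans)
  qed (rule sublinear_sublinear_at[OF m(1)])
  \<comment> \<open>With t = 1, m x \<le> m (x + y) - m y, the reverse of subadditivity.\<close>
  have add: "m (x + y) = m x + m y" for x y
    using sublinear_at_le[OF m(1), of 1 y x] sublinear_add[OF m(1), of x y] by (simp add: at)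
  have minus: "m (- x) = - m x" for x
    using add[of x "- x"] sublinear_zero[OF m(1)] by simp
  have "m (t *\<^sub>R x) = t * m x" for t x
    using sublinear_scale[OF m(1), of t x] sublinear_scale[OF m(1), of "- t" x] minus[of "t *\<^sub>R x"]
    by (cases "0 \<le> t") auto
  then have "linear m"
    by (intro linearI) (simp_all add: add)
  then show ?thesis
    using that m(2) by (auto simp: le_fun_def)
qed

text \<open>A linear minorant of \<open>sublinear_at norm v\<close> lies below the norm and, by t =
  1, has value at most - norm v at - v; hence it attains the norm at v.\<close>

lemma real_norming_functional:
  fixes v :: "'a::real_normed_vector"
  obtains f where "linear f" "\<And>x. \<bar>f x\<bar> \<le> norm x" "f v = norm v"
proof -
  have norm: "sublinear (norm :: 'a \<Rightarrow> real)"
    by (auto simp: sublinear_def norm_triangle_ineq)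
  obtain f where f: "linear f" "\<And>x. f x \<le> sublinear_at norm v x"
    using sublinear_dominates_linear[OF sublinear_sublinear_at[OF norm]] by blast
  have le: "f x \<le> norm x" for x
    using f(2)[of x] sublinear_at_le_self[OF norm, of v x] by simp
  moreover have "f (- v) \<le> - norm v"
    using f(2)[of "- v"] sublinear_at_le[OF norm, of 1 v "- v"] by simp
  moreover have minus: "f (- x) = - f x" for x
    using f(1) by (rule linear_neg)
  ultimately have "f v = norm v"
    by (metis neg_le_iff_le order_antisym)
  moreover have "\<bar>f x\<bar> \<le> norm x" for x
    using le[of x] le[of "- x"] minus[of x] by simp
  ultimately show ?thesis using that f(1) by blast
qed

section \<open>Norm-attaining elements of the dual over either field\<close>

lemma bounded_linear_onorm_eq_1I:
  assumes "linear f" "\<And>x. norm (f x) \<le> norm x" "v \<noteq> 0" "norm (f v) = norm v"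
  shows "bounded_linear f" "onorm f = 1"
proof -
  show bl: "bounded_linear f"
    using assms by (auto intro!: bounded_linear_intro[where K = 1] linear_add linear_scale)
  have "onorm f \<le> 1"
    by (rule onorm_bound) (use assms in auto)
  moreover have "norm v \<le> onorm f * norm v"
    using onorm[OF bl, of v] assms(4) by simp
  then have "1 \<le> onorm f"
    using assms(3) by (simp add: field_simps)
  ultimately show "onorm f = 1" by simp
qed

lemma real_dual_norming:
  fixes v :: "'a::real_normed_vector"
  assumes "v \<noteq> 0"
  shows "\<exists>f\<in>dual ((*\<^sub>R) :: real \<Rightarrow> 'a \<Rightarrow> 'a). onorm f = 1 \<and> f v = norm v"
proof -
  obtain f where f: "linear f" "\<And>x. \<bar>f x\<bar> \<le> norm x" "f v = norm v"
    using real_norming_functional[of v] by blast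
  then have "bounded_linear f" "onorm f = 1"
    using assms by (auto intro: bounded_linear_onorm_eq_1I[of f v])
  then show ?thesis
    using f by (intro bexI[of _ f]) (auto simp: dual_def linear_scale)
qed

lemma complex_dual_norming:
  fixes v :: "'a::real_normed_vector" and scl :: "complex \<Rightarrow> 'a \<Rightarrow> 'a"
  assumes "normed_space_over scl" "v \<noteq> 0"
  shows "\<exists>f\<in>dual scl. onorm f = 1 \<and> Re (f v) = norm v"
proof -
  interpret normed_space_over scl by fact
  obtain f where f: "linear f" "\<And>x. \<bar>f x\<bar> \<le> norm x" "f v = norm v"
    using real_norming_functional[of v] by blast
  \<comment> \<open>The only complex-linear candidate with real part f, since Im (g x) = - Re (g (i
    x)).\<close>
  define g where "g x = Complex (f x) (- f (scl \<i> x))" for x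
  have add: "g (x + y) = g x + g y" for x y
    by (simp add: g_def complex_eq_iff linear_add[OF f(1)] scale_right_distrib)
  have real: "scl (complex_of_real r) x = r *\<^sub>R x" for r x
    by (rule scale_of_real)
  have fr: "f (r *\<^sub>R x) = r * f x" for r x
    using linear_scale[OF f(1)] by simp
  have g_real: "g (scl (complex_of_real r) x) = complex_of_real r * g x" for r x
  proof -
    have "scl \<i> (r *\<^sub>R x) = r *\<^sub>R scl \<i> x"
      by (simp add: real[symmetric] mult.commute)
    then show ?thesis
      by (simp add: g_def complex_eq_iff real fr)
  qed
  have "scl \<i> (scl \<i> x) = - x" for x
    by (simp only: scale_scale) simp
  then have g_i: "g (scl \<i> x) = \<i> * g x" for x
    by (simp add: g_def complex_eq_iff linear_neg[OF f(1)])
  have scale: "g (scl c x) = c * g x" for c x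
  proof -
    have "scl c x = scl (complex_of_real (Re c)) x + scl (complex_of_real (Im c)) (scl \<i> x)"
      by (subst complex_eq[of c]) (simp add: scale_left_distrib mult.commute)
    then show ?thesis
      by (subst (2) complex_eq[of c]) (simp only: add g_real g_i ring_distribs mult_ac)
  qed
  have lin: "linear g"
    using g_real by (intro linearI add) (simp add: real scaleR_conv_of_real)
  have g_le: "norm (g x) \<le> norm x" for x
  proof (cases "g x = 0")
    case False
    \<comment> \<open>Multiplication by c makes g x real and nonnegative, so the bound on f at
      \<open>scl c x\<close> applies.\<close>
    define c where "c = cnj (sgn (g x))"
    have c: "norm c = 1" "c * g x = complex_of_real (norm (g x))"
      using False complex_norm_square[of "g x"]
      by (simp add: c_def norm_sgn, simp add: c_def sgn_eq power2_eq_square field_simps)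
    have "norm (g x) = Re (g (scl c x))"
      by (simp add: scale c)
    also have "\<dots> \<le> norm (scl c x)"
      using f(2)[of "scl c x"] by (simp add: g_def)
    finally show ?thesis
      by (simp add: norm_scale c)
  qed simp
  have "norm v \<le> norm (g v)"
    using complex_Re_le_cmod[of "g v"] by (simp add: g_def f(3))
  with g_le[of v] have "norm (g v) = norm v"
    by simp
  from bounded_linear_onorm_eq_1I[OF lin g_le assms(2) this] show ?thesis
    by (intro bexI[of _ g]) (auto simp: dual_def scale, simp add: g_def f(3))
qed

section \<open>The Lipschitz numerical index\<close>

text \<open>The directions along which \<open>f\<close> nowhere grows faster than at rate \<open>k\<close> form a convex set.\<close>

lemma increment_in_convex_hull:
  fixes f :: "'a::real_vector \<Rightarrow> real"
  assumes z: "z \<in> convex hull A" and "0 \<le> d" and gt: "k * d < f (u + d *\<^sub>R z) - f u"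
  obtains a l p where "a \<in> A" "0 < l" "k * l < f (p + l *\<^sub>R a) - f p"
proof -
  define G where "G = {a. \<forall>p. \<forall>l\<ge>0. f (p + l *\<^sub>R a) - f p \<le> k * l}"
  have "convex G"
  proof (rule convexI)
    fix a b :: 'a and s t :: real
    assume ab: "a \<in> G" "b \<in> G" and st: "0 \<le> s" "0 \<le> t" "s + t = 1"
    show "s *\<^sub>R a + t *\<^sub>R b \<in> G"
      unfolding G_def
    proof (intro CollectI allI impI)
      fix p and l :: real assume l: "0 \<le> l"
      \<comment> \<open>The step along the combination is made in two: along a, then along b from
        the point reached. This is why \<open>G\<close> quantifies over all base points.\<close>
      have "f (p + (l * s) *\<^sub>R a) - f p \<le> k * (l * s)"
        "f (p + (l * s) *\<^sub>R a + (l * t) *\<^sub>R b) - f (p + (l * s) *\<^sub>R a) \<le> k * (l * t)"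
        using ab l st by (simp_all add: G_def)
      moreover have "k * (l * s) + k * (l * t) = k * l"
        using st(3) by (metis distrib_left mult.right_neutral)
      ultimately show "f (p + l *\<^sub>R (s *\<^sub>R a + t *\<^sub>R b)) - f p \<le> k * l"
        by (simp add: algebra_simps)
    qed
  qed
  moreover have "z \<notin> G"
    using gt \<open>0 \<le> d\<close> by (auto simp: G_def not_le)
  ultimately have "\<not> A \<subseteq> G"
    using z hull_minimal[of A G convex] by blast
  then obtain a p l where a: "a \<in> A" "0 \<le> l" "k * l < f (p + l *\<^sub>R a) - f p"
    unfolding G_def subset_iff mem_Collect_eq not_le[symmetric] by blast
  moreover have "l \<noteq> 0" using a(3) by auto
  ultimately show ?thesis using that[of a l p] by simp
qed

section \<open>Lipschitz norm and numerical range\<close>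

lemma lip_norm_props:
  fixes T :: "'a::real_normed_vector \<Rightarrow> 'a"
  assumes "T \<in> Lip" and nt: "(UNIV :: 'a set) \<noteq> {0}"
  shows norm_diff_le_lip_norm: "norm (T x - T y) \<le> lip_norm T * norm (x - y)"
    and less_lip_normD: "c < lip_norm T \<Longrightarrow> \<exists>x y. x \<noteq> y \<and> c * norm (x - y) < norm (T x - T y)"
proof -
  let ?Q = "{norm (T x1 - T x2) / norm (x1 - x2) | x1 x2. x1 \<noteq> x2}"
  obtain L where L: "L-lipschitz_on UNIV T"
    using assms(1) by (auto simp: Lip_def)
  have "norm (T x - T y) \<le> L * norm (x - y)" for x y
    using lipschitz_onD[OF L, of x y] by (simp add: dist_norm)
  then have "bdd_above ?Q"
    by (intro bdd_aboveI[of _ L]) (auto simp: field_simps)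
  show "norm (T x - T y) \<le> lip_norm T * norm (x - y)"
  proof (cases "x = y")
    case False
    then have "norm (T x - T y) / norm (x - y) \<le> lip_norm T"
      unfolding lip_norm_def using \<open>bdd_above ?Q\<close> by (intro cSup_upper) auto
    then show ?thesis using False by (simp add: field_simps)
  qed simp
  \<comment> \<open>A nonzero vector yields a difference quotient, so the supremum is not over the
    empty set.\<close>
  obtain v :: 'a where "v \<noteq> 0" using nt by auto
  then have "?Q \<noteq> {}" by force
  assume "c < lip_norm T"
  then obtain x y where "x \<noteq> y" "c < norm (T x - T y) / norm (x - y)"
    unfolding lip_norm_def using less_cSup_iff[OF \<open>?Q \<noteq> {}\<close> \<open>bdd_above ?Q\<close>] by auto
  then show "\<exists>x y. x \<noteq> y \<and> c * norm (x - y) < norm (T x - T y)"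
    by (intro exI[of _ x] exI[of _ y]) (simp add: field_simps)
qed

text \<open>The common ground of both scalar fields. Norming functionals are assumed because their
  construction depends on the field.\<close>

locale normed_space_norming = normed_space_over scl
  for scl :: "'k::real_normed_field \<Rightarrow> 'a::banach \<Rightarrow> 'a" +
  fixes re :: "'k \<Rightarrow> real"
  assumes re_add: "re (s + t) = re s + re t"
    and re_of_real_mult: "re (of_real r * t) = r * re t"
    and re_le_norm: "re t \<le> norm t"
    and dual_norming: "v \<noteq> 0 \<Longrightarrow> \<exists>f\<in>dual scl. onorm f = 1 \<and> re (f v) = norm v"
begin

text \<open>The condition on f makes its norm equal to norm (x - y), which cancels one factor of the
  denominator; the Lipschitz bound cancels the other.\<close>

lemma num_range_le_lip:
  assumes T: "\<And>x y. norm (T x - T y) \<le> norm (x - y)" and "z \<in> num_range re scl T"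
  shows "norm z \<le> 1"
proof -
  obtain x y f where z: "z = f (T x - T y) / of_real ((norm (x - y))\<^sup>2)" and "x \<noteq> y"
    and f: "bounded_linear f" "onorm f * norm (x - y) = (norm (x - y))\<^sup>2"
    using assms(2) by (auto simp: num_range_def dual_def)
  have "norm (f (T x - T y)) \<le> onorm f * norm (T x - T y)"
    by (rule onorm[OF f(1)])
  also have "\<dots> \<le> (norm (x - y))\<^sup>2"
    using T[of x y] onorm_pos_le[OF f(1)] by (simp add: f(2)[symmetric] mult_left_mono)
  finally show ?thesis
    using \<open>x \<noteq> y\<close> by (simp add: z norm_divide norm_power)
qed

text \<open>Scaling a norm-one functional by norm (x - y) meets the normalisation in
  \<open>num_range\<close> and leaves only the first power in the denominator.\<close>

lemma norming_element:
  assumes "x \<noteq> y"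
  obtains f where "f \<in> dual scl" "onorm f = 1" "re (f (x - y)) = norm (x - y)"
    "f (T x - T y) / of_real (norm (x - y)) \<in> num_range re scl T"
proof -
  obtain f where f: "f \<in> dual scl" "onorm f = 1" "re (f (x - y)) = norm (x - y)"
    using dual_norming[of "x - y"] assms by auto
  let ?r = "norm (x - y)"
  let ?g = "\<lambda>v. ?r *\<^sub>R f v"
  have r: "?r \<noteq> 0" using assms by simp
  have bl: "bounded_linear f" using f(1) by (simp add: dual_def)
  have "?g \<in> dual scl"
    using f(1) bounded_linear_const_scaleR[OF bl, of ?r] by (auto simp: dual_def)
  moreover have "onorm ?g = ?r"
    using onorm_scaleR[OF bl, of ?r] f(2) by simp
  moreover have "re (?g (x - y)) = ?r * ?r"
    by (simp only: scaleR_conv_of_real re_of_real_mult f(3))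
  moreover have "f (T x - T y) / of_real ?r = ?g (T x - T y) / of_real (?r\<^sup>2)"
    using r by (simp add: scaleR_conv_of_real power2_eq_square)
  ultimately have "f (T x - T y) / of_real ?r \<in> num_range re scl T"
    unfolding num_range_def using assms
    by (intro CollectI exI[of _ x] exI[of _ y] exI[of _ ?g]) (simp add: power2_eq_square)
  then show ?thesis using that f by blast
qed

text \<open>A functional that almost attains its norm at \<open>s\<close> need not attain it nearby, and the
  Bishop-Phelps-Bollobas theorem is avoided as follows. The fixed point \<open>x = w + \<alpha> \<theta> (T x - T p)\<close>, where
  \<open>w = p + l \<theta> s\<close>, satisfies \<open>norm (x - p) \<le> l + \<alpha> \<mu> norm (x - p)\<close> by means of a functional norming
  \<open>x - p\<close>, whereas \<open>f\<close> bounds \<open>norm (x - p)\<close> from below by about \<open>l + \<alpha> l\<close>.\<close>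

lemma num_range_bound_ineq:
  assumes T: "\<And>x y. norm (T x - T y) \<le> norm (x - y)"
    and f: "f \<in> dual scl" "onorm f = 1"
    and \<theta>: "norm \<theta> = 1" and s: "norm s = 1" "1 - \<epsilon> < re (f s)" and l: "0 < l"
    and inc: "(1 - 3 * \<epsilon>) * l < re (f (T (p + l *\<^sub>R scl \<theta> s) - T p))"
    and \<alpha>: "0 < \<alpha>" "\<alpha> \<le> 1/4" and \<mu>: "\<mu> \<le> 1"
    and bound: "\<And>z. z \<in> num_range re scl T \<Longrightarrow> norm z \<le> \<mu>"
  shows "(1 - \<epsilon> + \<alpha> * (1 - 3 * \<epsilon> - 2 * \<alpha>)) * (1 - \<alpha> * \<mu>) \<le> 1"
proof -
  define w where "w = p + l *\<^sub>R scl \<theta> s"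
  \<comment> \<open>A contraction with factor \<alpha> < 1, as T is nonexpansive and \<theta> has
    modulus one.\<close>
  have "\<exists>!x. w + \<alpha> *\<^sub>R scl \<theta> (T x - T p) = x"
  proof (rule banach_fix_type[of \<alpha>], safe)
    fix x y
    have "dist (w + \<alpha> *\<^sub>R scl \<theta> (T x - T p)) (w + \<alpha> *\<^sub>R scl \<theta> (T y - T p))
        = norm (\<alpha> *\<^sub>R scl \<theta> (T x - T y))"
      by (simp add: dist_norm scale_right_diff_distrib algebra_simps)
    then show "dist (w + \<alpha> *\<^sub>R scl \<theta> (T x - T p)) (w + \<alpha> *\<^sub>R scl \<theta> (T y - T p)) \<le> \<alpha> * dist x y"
      using T[of x y] \<alpha> by (simp add: norm_scale \<theta> dist_norm)
  qed (use \<alpha> in auto)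
  then obtain x where x: "x = w + \<alpha> *\<^sub>R scl \<theta> (T x - T p)" by metis
  define D where "D = norm (x - p)"
  have norm_wp: "norm (w - p) = l"
    using l by (simp add: w_def norm_scale \<theta> s)
  have "x \<noteq> p"
  proof
    assume "x = p"
    with x have "w = p" by (simp add: scale_zero_right)
    with norm_wp l show False by simp
  qed
  then have D: "D > 0" by (simp add: D_def)
  have xp: "x - p = (w - p) + \<alpha> *\<^sub>R scl \<theta> (T x - T p)"
    by (subst x) simp
  have norm_xw: "norm (x - w) \<le> \<alpha> * D"
    using T[of x p] \<alpha> by (subst x) (simp add: norm_scale \<theta> D_def)
  have "D \<le> norm (w - p) + norm (x - w)"
    using norm_triangle_ineq[of "w - p" "x - w"] by (simp add: D_def)
  also have "\<dots> \<le> l + 1/4 * D"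
    using norm_xw mult_right_mono[OF \<alpha>(2), of D] D norm_wp by linarith
  finally have "D \<le> 2 * l" using l by simp
  then have "\<alpha> * D \<le> \<alpha> * (2 * l)"
    using \<alpha>(1) by (intro mult_left_mono) auto
  with norm_xw have norm_xw': "norm (x - w) \<le> 2 * \<alpha> * l"
    by simp

  have dualD: "h (y + z) = h y + h z" "h (r *\<^sub>R y) = of_real r * h y" "h (scl c y) = c * h y"
    "onorm h = 1 \<Longrightarrow> re (h y) \<le> norm y" "onorm h = 1 \<Longrightarrow> norm (h y) \<le> norm y"
    if "h \<in> dual scl" for h y z r c
  proof -
    have h: "bounded_linear h" using that by (simp add: dual_def)
    then interpret h: bounded_linear h .
    show "h (y + z) = h y + h z" by (rule h.add)
    show "h (r *\<^sub>R y) = of_real r * h y" by (simp add: h.scaleR scaleR_conv_of_real)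
    show "h (scl c y) = c * h y" using that by (simp add: dual_def)
    show "norm (h y) \<le> norm y" if "onorm h = 1"
      using onorm[OF h, of y] that by simp
    then show "re (h y) \<le> norm y" if "onorm h = 1"
      using re_le_norm[of "h y"] that by linarith
  qed

  \<comment> \<open>Passing from T w, where the increment is known, to T x costs at most norm (x -
    w) \<le> 2 \<alpha> l.\<close>
  have "f (T w - T p) = f (T w - T x) + f (T x - T p)"
    using dualD(1)[OF f(1), of "T w - T x" "T x - T p"] by simp
  then have "re (f (T w - T p)) = re (f (T w - T x)) + re (f (T x - T p))"
    by (simp add: re_add)
  moreover have "re (f (T w - T x)) \<le> 2 * \<alpha> * l"
    using dualD(4)[OF f, of "T w - T x"] T[of w x] norm_xw' by (simp add: norm_minus_commute)
  ultimately have "(1 - 3 * \<epsilon> - 2 * \<alpha>) * l \<le> re (f (T x - T p))"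
    using inc by (simp add: w_def algebra_simps)
  then have "\<alpha> * ((1 - 3 * \<epsilon> - 2 * \<alpha>) * l) \<le> \<alpha> * re (f (T x - T p))"
    using \<alpha>(1) by (intro mult_left_mono) auto
  moreover have "(1 - \<epsilon>) * l \<le> l * re (f s)"
    using s(2) l by simp
  moreover have "l * re (f s) + \<alpha> * re (f (T x - T p)) \<le> D"
  proof -
    have "\<theta> \<noteq> 0" using \<theta> by auto
    \<comment> \<open>Here x - p = \<theta> (l s + \<alpha> (T x - T p)); dividing by \<theta> keeps
      the norm and lets the two real parts add up.\<close>
    have "f (x - p) = \<theta> * (of_real l * f s + of_real \<alpha> * f (T x - T p))"
      unfolding xp w_def add_diff_cancel_left'
      by (simp only: dualD(1-3)[OF f(1)] distrib_left mult.left_commute)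
    then have "f (scl (inverse \<theta>) (x - p)) = of_real l * f s + of_real \<alpha> * f (T x - T p)"
      using \<open>\<theta> \<noteq> 0\<close> by (simp only: dualD(3)[OF f(1)]) simp
    then have "l * re (f s) + \<alpha> * re (f (T x - T p)) = re (f (scl (inverse \<theta>) (x - p)))"
      by (simp add: re_add re_of_real_mult)
    also have "\<dots> \<le> D"
      using dualD(4)[OF f, of "scl (inverse \<theta>) (x - p)"]
      by (simp add: norm_scale norm_inverse \<theta> D_def)
    finally show ?thesis .
  qed
  ultimately have lower: "(1 - \<epsilon> + \<alpha> * (1 - 3 * \<epsilon> - 2 * \<alpha>)) * l \<le> D"
    by (simp add: algebra_simps)

  \<comment> \<open>For the upper estimate g norms x - p exactly, so its value on T x - T p comes
    from the numerical range and is controlled by \<mu>.\<close>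
  obtain g where g: "g \<in> dual scl" "onorm g = 1" "re (g (x - p)) = D"
    and "g (T x - T p) / of_real D \<in> num_range re scl T"
    using norming_element[OF \<open>x \<noteq> p\<close>] unfolding D_def by blast
  then have "norm (g (T x - T p)) \<le> \<mu> * D"
    using bound[of "g (T x - T p) / of_real D"] D by (simp add: norm_divide field_simps)
  then have "re (\<theta> * g (T x - T p)) \<le> \<mu> * D"
    using re_le_norm[of "\<theta> * g (T x - T p)"] by (simp add: norm_mult \<theta>)
  moreover have "D = re (g (w - p)) + \<alpha> * re (\<theta> * g (T x - T p))"
    unfolding g(3)[symmetric] by (subst xp) (simp add: dualD[OF g(1)] re_add re_of_real_mult)
  moreover have "re (g (w - p)) \<le> l"
    using dualD(4)[OF g(1,2), of "w - p"] by (simp add: norm_wp)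
  ultimately have "D \<le> l + \<alpha> * (\<mu> * D)"
    using \<alpha>(1) by (smt (verit) mult_left_mono)
  then have upper: "D * (1 - \<alpha> * \<mu>) \<le> l"
    by (simp add: algebra_simps)
  have "\<alpha> * \<mu> \<le> \<alpha> * 1"
    using \<alpha> \<mu> by (intro mult_left_mono) auto
  then have "0 \<le> 1 - \<alpha> * \<mu>"
    using \<alpha>(2) by linarith
  with lower have "(1 - \<epsilon> + \<alpha> * (1 - 3 * \<epsilon> - 2 * \<alpha>)) * l * (1 - \<alpha> * \<mu>) \<le> D * (1 - \<alpha> * \<mu>)"
    by (rule mult_right_mono)
  with upper have "((1 - \<epsilon> + \<alpha> * (1 - 3 * \<epsilon> - 2 * \<alpha>)) * (1 - \<alpha> * \<mu>)) * l \<le> 1 * l"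
    by (simp add: mult.assoc mult.commute mult.left_commute)
  then show ?thesis using l by simp
qed

text \<open>Three losses of order \<epsilon> occur: from the norm of T, from the slice, and from
  replacing a - b by d z. Together, (1 - \<epsilon>)^2 - \<epsilon> \<ge> 1 - 3 \<epsilon>.\<close>

lemma lush_increment:
  assumes lush: "lush re scl" and T: "T \<in> Lip" "lip_norm T = 1"
    and \<epsilon>: "0 < \<epsilon>" "\<epsilon> < 1" and nt: "(UNIV :: 'a set) \<noteq> {0}"
  obtains f \<theta> s l p where "f \<in> dual scl" "onorm f = 1" "norm \<theta> = 1" "norm s = 1" "1 - \<epsilon> < re (f s)"
    "0 < l" "(1 - 3 * \<epsilon>) * l < re (f (T (p + l *\<^sub>R scl \<theta> s) - T p))"
proof -
  have T_le: "norm (T x - T y) \<le> norm (x - y)" for x y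
    using norm_diff_le_lip_norm[OF T(1) nt, of x y] T(2) by simp
  obtain a b where ab: "a \<noteq> b" "(1 - \<epsilon>) * norm (a - b) < norm (T a - T b)"
    using less_lip_normD[OF T(1) nt, of "1 - \<epsilon>"] T(2) \<epsilon>(1) by auto
  define d where "d = norm (a - b)"
  define e where "e = norm (T a - T b)"
  have d: "d > 0" and e: "e > (1 - \<epsilon>) * d"
    using ab by (auto simp: d_def e_def)
  then have e0: "e > 0" using \<epsilon>(2) by (smt (verit) mult_pos_pos)
  have "(a - b) /\<^sub>R d \<in> sphere 0 1" "(T a - T b) /\<^sub>R e \<in> sphere 0 1"
    using d e0 by (simp_all add: d_def e_def)
  then obtain f where f: "f \<in> dual scl" "onorm f = 1"
    and y: "(T a - T b) /\<^sub>R e \<in> slice re f \<epsilon>"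
    and dist: "infdist ((a - b) /\<^sub>R d)
      (convex hull {scl \<theta> s | \<theta> s. norm \<theta> = 1 \<and> s \<in> slice re f \<epsilon>}) < \<epsilon>"
    using lush \<epsilon>(1) unfolding lush_def by blast
  let ?A = "{scl \<theta> s | \<theta> s. norm \<theta> = 1 \<and> s \<in> slice re f \<epsilon>}"
  \<comment> \<open>Excludes the default value of \<open>infdist\<close> for the empty set, so that
    a nearby z exists.\<close>
  have "scl 1 ((T a - T b) /\<^sub>R e) \<in> ?A"
    using y norm_one by blast
  then have "convex hull ?A \<noteq> {}"
    using hull_subset[of ?A convex] by blast
  then obtain z where z: "z \<in> convex hull ?A" "dist ((a - b) /\<^sub>R d) z < \<epsilon>"
    using dist by (auto simp: infdist_notempty cINF_less_iff)
  have bl: "bounded_linear f" using f(1) by (simp add: dual_def)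
  then interpret f: bounded_linear f .
  have re_f_le: "re (f v) \<le> norm v" for v
    using re_le_norm[of "f v"] onorm[OF bl, of v] f(2) by simp
  have re_diff: "re (s - t) = re s - re t" for s t
    using re_add[of "s - t" t] by simp
  define F where "F v = re (f (T v))" for v

  have "(1 - \<epsilon>) * e < re (f (T a - T b))"
  proof -
    have "re (f ((T a - T b) /\<^sub>R e)) = inverse e * re (f (T a - T b))"
      by (simp only: f.scaleR scaleR_conv_of_real re_of_real_mult)
    then have "1 - \<epsilon> < inverse e * re (f (T a - T b))"
      using y by (simp only: slice_def mem_Collect_eq)
    then show ?thesis
      using e0 by (simp add: field_simps)
  qed
  moreover have "(1 - \<epsilon>) * ((1 - \<epsilon>) * d) < (1 - \<epsilon>) * e"
    using e \<epsilon>(2) by simp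
  ultimately have "(1 - \<epsilon>) * ((1 - \<epsilon>) * d) < F a - F b"
    by (simp add: F_def f.diff re_diff)
  moreover have "F a - F (b + d *\<^sub>R z) \<le> d * \<epsilon>"
  proof -
    have "F a - F (b + d *\<^sub>R z) \<le> norm (a - (b + d *\<^sub>R z))"
      using re_f_le[of "T a - T (b + d *\<^sub>R z)"] T_le[of a "b + d *\<^sub>R z"]
      by (simp add: F_def f.diff re_diff)
    also have "a - (b + d *\<^sub>R z) = d *\<^sub>R ((a - b) /\<^sub>R d - z)"
      using d by (simp add: algebra_simps)
    also have "norm \<dots> \<le> d * \<epsilon>"
      using z(2) d by (simp add: dist_norm)
    finally show ?thesis .
  qed
  moreover have "(1 - \<epsilon>) * ((1 - \<epsilon>) * d) - d * \<epsilon> = (1 - 3 * \<epsilon>) * d + \<epsilon> * \<epsilon> * d"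
    by (simp add: algebra_simps)
  moreover have "0 \<le> \<epsilon> * \<epsilon> * d" using d by simp
  ultimately have "(1 - 3 * \<epsilon>) * d < F (b + d *\<^sub>R z) - F b"
    by linarith
  then obtain c l p where c: "c \<in> ?A" "0 < l" "(1 - 3 * \<epsilon>) * l < F (p + l *\<^sub>R c) - F p"
    using increment_in_convex_hull[OF z(1) less_imp_le[OF d], of "1 - 3 * \<epsilon>" F b] by blast
  then obtain \<theta> s where "c = scl \<theta> s" "norm \<theta> = 1" "s \<in> slice re f \<epsilon>" by blast
  with c f that[of f \<theta> s l p] show ?thesis
    by (auto simp: slice_def F_def f.diff re_diff)
qed

text \<open>The Lipschitz estimate gives the upper bound 1. A smaller value \<mu> would contradict
  \<open>num_range_bound_ineq\<close> at second order in \<alpha>, with \<alpha> a fixed multiple of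
  1 - \<mu>.\<close>

lemma num_radius_lush:
  assumes lush: "lush re scl" and T: "T \<in> Lip" "lip_norm T = 1" and nt: "(UNIV :: 'a set) \<noteq> {0}"
  shows "num_radius re scl T = 1"
proof -
  have T_le: "norm (T x - T y) \<le> norm (x - y)" for x y
    using norm_diff_le_lip_norm[OF T(1) nt, of x y] T(2) by simp
  let ?N = "{norm z | z. z \<in> num_range re scl T}"
  obtain v :: 'a where "v \<noteq> 0" using nt by auto
  then obtain z where z: "z \<in> num_range re scl T"
    by (rule norming_element)
  have le: "norm z \<le> 1" if "z \<in> num_range re scl T" for z
    using num_range_le_lip[OF T_le that] .
  then have bdd: "bdd_above ?N" by (intro bdd_aboveI[of _ 1]) auto
  define \<mu> where "\<mu> = num_radius re scl T"
  have bound: "norm z \<le> \<mu>" if "z \<in> num_range re scl T" for z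
    unfolding \<mu>_def num_radius_def using that bdd by (intro cSup_upper) auto
  have "\<mu> \<le> 1"
    unfolding \<mu>_def num_radius_def using z le by (intro cSup_least) auto
  moreover have "\<mu> \<ge> 0" using bound[OF z] norm_ge_zero[of z] by linarith
  moreover have "\<not> \<mu> < 1"
  proof
    assume "\<mu> < 1"
    \<comment> \<open>First-order terms in \<alpha> cancel. At second order 1 - \<mu> contributes 4,
      against losses 2, 1 and, from \<epsilon>, 1/3; the remaining 2/3 is positive.\<close>
    define \<alpha> where "\<alpha> = (1 - \<mu>) / 4"
    define \<epsilon> where "\<epsilon> = \<alpha>\<^sup>2 / 3"
    have \<alpha>: "0 < \<alpha>" "\<alpha> \<le> 1/4" and \<mu>_eq: "\<mu> = 1 - 4 * \<alpha>"
      using \<open>\<mu> < 1\<close> \<open>\<mu> \<ge> 0\<close> by (auto simp: \<alpha>_def field_simps)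
    have "\<alpha> * \<alpha> \<le> 1/4 * (1/4)" using \<alpha> by (intro mult_mono) auto
    then have \<epsilon>: "0 < \<epsilon>" "\<epsilon> < 1" using \<alpha> by (simp_all add: \<epsilon>_def power2_eq_square)
    obtain f \<theta> s l p where "f \<in> dual scl" "onorm f = 1" "norm \<theta> = 1" "norm s = 1" "1 - \<epsilon> < re (f s)"
      "0 < l" "(1 - 3 * \<epsilon>) * l < re (f (T (p + l *\<^sub>R scl \<theta> s) - T p))"
      using lush_increment[OF lush T \<epsilon> nt] by blast
    from num_range_bound_ineq[OF T_le this \<alpha> \<open>\<mu> \<le> 1\<close> bound]
    have "(1 - \<epsilon> + \<alpha> * (1 - 3 * \<epsilon> - 2 * \<alpha>)) * (1 - \<alpha> * \<mu>) \<le> 1" .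
    moreover have "(1 - \<epsilon> + \<alpha> * (1 - 3 * \<epsilon> - 2 * \<alpha>)) * (1 - \<alpha> * \<mu>) - 1
        = \<alpha>\<^sup>2 * (2/3 + \<alpha> * (16/3 - 25/3 * \<alpha> - 4 * (\<alpha> * \<alpha>)))"
      unfolding \<epsilon>_def \<mu>_eq by (simp add: field_simps power2_eq_square)
    moreover have "0 < \<alpha>\<^sup>2 * (2/3 + \<alpha> * (16/3 - 25/3 * \<alpha> - 4 * (\<alpha> * \<alpha>)))"
      using \<alpha> \<open>\<alpha> * \<alpha> \<le> 1/4 * (1/4)\<close> by (intro mult_pos_pos add_pos_nonneg mult_nonneg_nonneg) auto
    ultimately show False by linarith
  qed
  ultimately show ?thesis by (simp add: \<mu>_def)
qed

text \<open>All radii in question equal 1, and the identity shows that the infimum is not over the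
  empty set.\<close>

lemma lip_num_index_lush:
  assumes lush: "lush re scl" and nt: "(UNIV :: 'a set) \<noteq> {0}"
  shows "lip_num_index re scl = 1"
proof -
  obtain v :: 'a where "v \<noteq> 0" using nt by auto
  then have "norm (v - 0) / norm (v - 0) = 1" "v \<noteq> 0" by simp_all
  then have "{norm (x1 - x2) / norm (x1 - x2) | x1 x2 :: 'a. x1 \<noteq> x2} = {1}"
    by (intro equalityI subsetI) (force, metis (mono_tags, lifting) mem_Collect_eq singletonD)
  then have "lip_norm (\<lambda>x :: 'a. x) = 1"
    by (simp add: lip_norm_def)
  moreover have "(\<lambda>x :: 'a. x) \<in> Lip"
    by (auto simp: Lip_def intro!: exI[of _ 1] lipschitz_onI)
  ultimately have "{num_radius re scl T | T. T \<in> Lip \<and> lip_norm T = 1} = {1}"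
    using num_radius_lush[OF lush _ _ nt]
    by (intro equalityI subsetI) (blast, metis (mono_tags, lifting) mem_Collect_eq singletonD)
  then show ?thesis by (simp add: lip_num_index_def)
qed

end

text \<open>The zero space is excluded because it has no difference quotients. Both fields are
  instances of \<open>normed_space_norming\<close>.\<close>

theorem theorem4p1:
  assumes "(UNIV :: 'a::banach set) \<noteq> {0}"
  shows "(lush (\<lambda>t::real. t) ((*\<^sub>R) :: real \<Rightarrow> 'a \<Rightarrow> 'a) \<longrightarrow>
            lip_num_index (\<lambda>t::real. t) ((*\<^sub>R) :: real \<Rightarrow> 'a \<Rightarrow> 'a) = 1) \<and>
         (\<forall>cscale :: complex \<Rightarrow> 'a \<Rightarrow> 'a. normed_space_over cscale \<longrightarrow> lush Re cscale \<longrightarrow>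
            lip_num_index Re cscale = 1)"
proof (intro conjI allI impI)
  interpret normed_space_norming "(*\<^sub>R) :: real \<Rightarrow> 'a \<Rightarrow> 'a" "\<lambda>t. t"
  proof (intro normed_space_norming.intro normed_space_norming_axioms.intro)
    show "normed_space_over ((*\<^sub>R) :: real \<Rightarrow> 'a \<Rightarrow> 'a)"
      by unfold_locales (simp_all add: scaleR_add_right scaleR_add_left)
  qed (use real_dual_norming in auto)
  assume "lush (\<lambda>t::real. t) ((*\<^sub>R) :: real \<Rightarrow> 'a \<Rightarrow> 'a)"
  then show "lip_num_index (\<lambda>t::real. t) ((*\<^sub>R) :: real \<Rightarrow> 'a \<Rightarrow> 'a) = 1"
    using assms by (rule lip_num_index_lush)
next
  fix cscale :: "complex \<Rightarrow> 'a \<Rightarrow> 'a"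
  assume cscale: "normed_space_over cscale" and lush: "lush Re cscale"
  interpret normed_space_norming cscale Re
    by (intro normed_space_norming.intro normed_space_norming_axioms.intro
        cscale complex_dual_norming[OF cscale])
      (simp_all add: complex_Re_le_cmod)
  show "lip_num_index Re cscale = 1"
    using lush assms by (rule lip_num_index_lush)
qed

end
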